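(* Let $\mathcal L$ be a join-semilattice with greatest element $1$, equipped with a binary operation $\mathbin{\hat{\ }}$ (caret) satisfying the following axioms for all $x,y,z\in\mathcal L$, where $x\rightarrow y$ denotes $y\vee\bigl(1\mathbin{\hat{\ }}(x\mathbin{\hat{\ }}y)\bigr)$: (a) $x\vee(y\mathbin{\hat{\ }}x)=x\vee y$; (b) $(1\mathbin{\hat{\ }}x)\mathbin{\hat{\ }}(1\mathbin{\hat{\ }}y)=1\mathbin{\hat{\ }}(x\mathbin{\hat{\ }}y)$; (c) $1\mathbin{\hat{\ }}(1\mathbin{\hat{\ }}x)=x$; (d) if $x\le y$ then $1\mathbin{\hat{\ }}x\le 1\mathbin{\hat{\ }}y$; (e) (i) $(x\rightarrow y)\rightarrow y=x\vee y$, and (ii) $x\rightarrow(y\rightarrow z)=y\rightarrow(x\rightarrow z)$; (f) $(x\vee y)\rightarrow\bigl((x\vee y)\mathbin{\hat{\ }}y\bigr)=1\mathbin{\hat{\ }}(x\rightarrow y)$; (g) $x\mathbin{\hat{\ }}y\le(x\vee y)\mathbin{\hat{\ }}y$; (h) $x\mathbin{\hat{\ }}y\le x$; (i) $(x\vee y)\mathbin{\hat{\ }}y\le x\rightarrow(x\mathbin{\hat{\ }}y)$. Then $\mathcal L$, with $\Delta(a,b)=a\mathbin{\hat{\ }}b$ for $b\le a$, is an MR-algebra, and for all $x,y\in\mathcal L$ the meet $x\wedge\Delta(x\vee y,y)$ exists and $x\mathbin{\hat{\ }}y=x\wedge\Delta(x\vee y,y)$.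
   Context: A cubic algebra is a join-semilattice with greatest element $1$ and an operation $\Delta$ (only the values $\Delta(y,x)$ with $x\le y$ matter) such that: (1) $x\le y$ implies $\Delta(y,x)\vee x=y$; (2) $x\le y\le z$ implies $\Delta(z,\Delta(y,x))=\Delta(\Delta(z,y),\Delta(z,x))$; (3) $x\le y$ implies $\Delta(y,\Delta(y,x))=x$; (4) $x\le y\le z$ implies $\Delta(z,x)\le\Delta(z,y)$; and, writing $xy=\Delta(1,\Delta(x\vee y,y))\vee y$, (5) $(xy)y=x\vee y$; (6) $x(yz)=y(xz)$. An MR-algebra is a cubic algebra satisfying the MR-axiom: for all $a,b<x$, $\Delta(x,a)\vee b<x$ if and only if the meet (greatest lower bound) $a\wedge b$ does not exist. *)

theory Defs
  imports "HOL-Library.Lub_Glb"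
begin

unbundle lattice_syntax

definition cubic_mult ::
    "('a::{semilattice_sup,order_top} \<Rightarrow> 'a \<Rightarrow> 'a) \<Rightarrow> 'a \<Rightarrow> 'a \<Rightarrow> 'a" where
  "cubic_mult \<Delta> x y = \<Delta> \<top> (\<Delta> (x \<squnion> y) y) \<squnion> y"

text \<open>
  \<open>\<Delta> y x\<close> is meaningful only for \<open>x \<le> y\<close>. Here \<open>\<Delta>\<close> is a total function, but the axioms,
  including the MR-axiom below, only ever evaluate it at such pairs, so its remaining values are
  unconstrained.
\<close>

locale cubic_algebra =
  fixes \<Delta> :: "'a::{semilattice_sup,order_top} \<Rightarrow> 'a \<Rightarrow> 'a"
  assumes Delta_sup: "x \<le> y \<Longrightarrow> \<Delta> y x \<squnion> x = y"
    and Delta_Delta: "x \<le> y \<Longrightarrow> y \<le> z \<Longrightarrow> \<Delta> z (\<Delta> y x) = \<Delta> (\<Delta> z y) (\<Delta> z x)"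
    and Delta_invol: "x \<le> y \<Longrightarrow> \<Delta> y (\<Delta> y x) = x"
    and Delta_mono: "x \<le> y \<Longrightarrow> y \<le> z \<Longrightarrow> \<Delta> z x \<le> \<Delta> z y"
    and mult_mult_same: "cubic_mult \<Delta> (cubic_mult \<Delta> x y) y = x \<squnion> y"
    and mult_left_commute:
      "cubic_mult \<Delta> x (cubic_mult \<Delta> y z) = cubic_mult \<Delta> y (cubic_mult \<Delta> x z)"

locale MR_algebra = cubic_algebra +
  assumes MR: "a < x \<Longrightarrow> b < x \<Longrightarrow> \<Delta> x a \<squnion> b < x \<longleftrightarrow> \<not> (\<exists>m. isGlb UNIV {a, b} m)"

definition caret_imp ::
    "('a::{semilattice_sup,order_top} \<Rightarrow> 'a \<Rightarrow> 'a) \<Rightarrow> 'a \<Rightarrow> 'a \<Rightarrow> 'a" where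
  "caret_imp car x y = y \<squnion> car \<top> (car x y)"

end

theory Submission
  imports Defs
begin

text \<open>
  The operation \<open>\<rightarrow>\<close> makes the semilattice an implication algebra: axiom (e) gives the commutative
  BCK part, and \<open>x \<squnion> (x \<rightarrow> y) = \<top>\<close> follows from (a), (b) and (h). Consequently an element
  \<open>d \<le> x\<close> is determined by \<open>x \<rightarrow> d\<close>, being the meet of \<open>x\<close> and \<open>x \<rightarrow> d\<close>. By (f), for \<open>y \<le> x\<close> the
  element \<open>x ^ y\<close> is then the unique \<open>d \<le> x\<close> with \<open>x \<rightarrow> d = 1 ^ (x \<rightarrow> y)\<close>, from which the cubic
  axioms follow, since \<open>1 ^ -\<close> is an involutive automorphism. By (g), (h) and (i), \<open>x ^ y\<close> is
  the meet of \<open>x\<close> and \<open>(x \<squnion> y) ^ y\<close>; applied to \<open>b\<close> and \<open>x ^ a\<close> this yields the MR-axiom.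
\<close>

locale commutative_implication =
  fixes imp :: "'a::{semilattice_sup,order_top} \<Rightarrow> 'a \<Rightarrow> 'a"  (infixr "\<rightarrow>" 60)
  assumes imp_imp_same: "(x \<rightarrow> y) \<rightarrow> y = x \<squnion> y"
    and imp_left_commute: "x \<rightarrow> (y \<rightarrow> z) = y \<rightarrow> (x \<rightarrow> z)"
    and top_imp: "\<top> \<rightarrow> x = x"
begin

lemma imp_self: "x \<rightarrow> x = \<top>"
  using imp_imp_same[of \<top> x] by (simp add: top_imp sup_absorb1)

lemma imp_top: "x \<rightarrow> \<top> = \<top>"
proof -
  have "x \<rightarrow> \<top> = x \<rightarrow> ((x \<rightarrow> \<top>) \<rightarrow> \<top>)"
    by (simp add: imp_imp_same sup_absorb2)
  also have "\<dots> = \<top>"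
    by (subst imp_left_commute) (rule imp_self)
  finally show ?thesis .
qed

lemma le_if_imp_eq_top: "x \<rightarrow> y = \<top> \<Longrightarrow> x \<le> y"
  using imp_imp_same[of x y] by (simp add: top_imp le_iff_sup)

lemma le_imp: "y \<le> x \<rightarrow> y"
  by (rule le_if_imp_eq_top) (subst imp_left_commute, simp add: imp_self imp_top)

lemma le_iff_imp: "x \<le> y \<longleftrightarrow> x \<rightarrow> y = \<top>"
proof
  assume "x \<le> y"
  then have "(x \<rightarrow> y) \<rightarrow> y = y"
    by (simp add: imp_imp_same sup_absorb2)
  then have "(x \<rightarrow> y) \<squnion> y = \<top>"
    using imp_imp_same[of "x \<rightarrow> y" y] by (simp add: imp_self)
  with le_imp show "x \<rightarrow> y = \<top>"
    by (simp add: sup_absorb1)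
qed (rule le_if_imp_eq_top)

lemma le_imp_swap: "x \<le> y \<rightarrow> z \<longleftrightarrow> y \<le> x \<rightarrow> z"
  unfolding le_iff_imp by (subst imp_left_commute) (rule refl)

text \<open>Rewriting \<open>x \<squnion> y\<close> as
  \<open>(x \<rightarrow> y) \<rightarrow> y\<close> leaves a triple implication into
  \<open>y\<close>, which is the join of \<open>x \<rightarrow> y\<close> and
  \<open>y\<close>.\<close>

lemma sup_imp: "(x \<squnion> y) \<rightarrow> y = x \<rightarrow> y"
proof -
  have "(x \<squnion> y) \<rightarrow> y = (x \<rightarrow> y) \<squnion> y"
    by (simp flip: imp_imp_same)
  then show ?thesis
    by (simp add: le_imp sup_absorb1)
qed

lemma imp_antimono: "x \<le> y \<Longrightarrow> y \<rightarrow> z \<le> x \<rightarrow> z"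
  by (subst le_imp_swap) (simp add: imp_imp_same le_supI1)

lemma imp_mono:
  assumes "y \<le> z"
  shows "x \<rightarrow> y \<le> x \<rightarrow> z"
proof -
  \<comment> \<open>Writing \<open>z\<close> as an implication lets the exchange law bring out
    \<open>x \<rightarrow> y\<close> as a conclusion.\<close>
  have "x \<rightarrow> z = x \<rightarrow> ((z \<rightarrow> y) \<rightarrow> y)"
    using assms by (simp add: imp_imp_same sup_absorb1)
  also have "\<dots> = (z \<rightarrow> y) \<rightarrow> (x \<rightarrow> y)"
    by (rule imp_left_commute)
  finally show ?thesis
    by (simp add: le_imp)
qed

lemma imp_trans: "x \<rightarrow> y \<le> (y \<rightarrow> z) \<rightarrow> (x \<rightarrow> z)"
  by (subst imp_left_commute) (simp add: imp_imp_same imp_mono)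

end

locale implication_algebra = commutative_implication +
  assumes sup_imp_top: "x \<squnion> (x \<rightarrow> y) = \<top>"
begin

text \<open>Modus ponens: \<open>w \<rightarrow> y\<close> lies above both \<open>x\<close> and
  \<open>x \<rightarrow> y\<close>, whose join is the top.\<close>

lemma le_if_le_imp:
  assumes "w \<le> x" and "w \<le> x \<rightarrow> y"
  shows "w \<le> y"
proof -
  have "x \<le> w \<rightarrow> y" and "x \<rightarrow> y \<le> w \<rightarrow> y"
    using assms by (simp_all add: le_imp_swap[of x] imp_antimono)
  then have "\<top> \<le> w \<rightarrow> y"
    by (metis sup_imp_top sup_least)
  then show ?thesis
    by (simp add: le_iff_imp top_imp)
qed

lemma le_if_imp_le_imp: "y \<le> x \<Longrightarrow> x \<rightarrow> y \<le> x \<rightarrow> z \<Longrightarrow> y \<le> z"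
  using le_if_le_imp le_imp order_trans by blast

lemma eq_if_imp_eq: "y \<le> x \<Longrightarrow> z \<le> x \<Longrightarrow> x \<rightarrow> y = x \<rightarrow> z \<Longrightarrow> y = z"
  by (simp add: le_if_imp_le_imp order_antisym)

lemma imp_imp_imp:
  assumes "p \<le> z"
  shows "(z \<rightarrow> p) \<rightarrow> (z \<rightarrow> q) = p \<rightarrow> q"
proof (rule order_antisym)
  have "\<top> \<le> z \<squnion> (p \<rightarrow> q)"
    using assms sup_imp_top[of p q] by (metis sup_mono order_refl)
  then have "(z \<rightarrow> (p \<rightarrow> q)) \<rightarrow> (p \<rightarrow> q) = \<top>"
    by (simp add: imp_imp_same top_unique)
  then have "z \<rightarrow> (p \<rightarrow> q) \<le> p \<rightarrow> q"
    by (rule le_if_imp_eq_top)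
  moreover have "(z \<rightarrow> p) \<rightarrow> (z \<rightarrow> q) \<le> p \<rightarrow> (z \<rightarrow> q)"
    by (rule imp_antimono) (rule le_imp)
  ultimately show "(z \<rightarrow> p) \<rightarrow> (z \<rightarrow> q) \<le> p \<rightarrow> q"
    using imp_left_commute[of z p q] by simp
  show "p \<rightarrow> q \<le> (z \<rightarrow> p) \<rightarrow> (z \<rightarrow> q)"
    by (subst le_imp_swap) (rule imp_trans)
qed

end

locale caret_algebra =
  fixes car :: "'a::{semilattice_sup,order_top} \<Rightarrow> 'a \<Rightarrow> 'a"
  assumes sup_car: "x \<squnion> car y x = x \<squnion> y"
    and car_car_top: "car (car \<top> x) (car \<top> y) = car \<top> (car x y)"
    and top_car_invol: "car \<top> (car \<top> x) = x"
    and top_car_mono: "x \<le> y \<Longrightarrow> car \<top> x \<le> car \<top> y"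
    and caret_imp_imp_same: "caret_imp car (caret_imp car x y) y = x \<squnion> y"
    and caret_imp_left_commute:
      "caret_imp car x (caret_imp car y z) = caret_imp car y (caret_imp car x z)"
    and sup_imp_sup_car: "caret_imp car (x \<squnion> y) (car (x \<squnion> y) y) = car \<top> (caret_imp car x y)"
    and car_le_sup_car: "car x y \<le> car (x \<squnion> y) y"
    and car_le: "car x y \<le> x"
    and sup_car_le_imp_car: "car (x \<squnion> y) y \<le> caret_imp car x (car x y)"
begin

abbreviation imp  (infixr "\<rightarrow>" 60) where "x \<rightarrow> y \<equiv> caret_imp car x y"
text \<open>Despite the notation this is not an order-reversing complement: (d) makes it monotone,
  like the antipodal map on the faces of a cube.\<close>

abbreviation compl  ("_\<^sup>c" [1000] 999) where "x\<^sup>c \<equiv> car \<top> x"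

sublocale commutative_implication imp
proof
  show "\<top> \<rightarrow> x = x" for x
    by (simp add: caret_imp_def top_car_invol)
qed (fact caret_imp_imp_same caret_imp_left_commute)+

lemma compl_le_iff: "x\<^sup>c \<le> y\<^sup>c \<longleftrightarrow> x \<le> y"
  by (metis top_car_mono top_car_invol)

lemma compl_sup: "(x \<squnion> y)\<^sup>c = x\<^sup>c \<squnion> y\<^sup>c"
proof (rule order_antisym)
  have "x \<squnion> y \<le> (x\<^sup>c \<squnion> y\<^sup>c)\<^sup>c"
    by (metis compl_le_iff top_car_invol sup_ge1 sup_ge2 sup_least)
  then show "(x \<squnion> y)\<^sup>c \<le> x\<^sup>c \<squnion> y\<^sup>c"
    by (metis compl_le_iff top_car_invol)
qed (simp add: top_car_mono)

lemma compl_imp: "(x \<rightarrow> y)\<^sup>c = x\<^sup>c \<rightarrow> y\<^sup>c"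
  by (simp add: caret_imp_def compl_sup car_car_top)

lemma le_sup_compl_top:
  assumes "z \<le> x"
  shows "x \<squnion> z\<^sup>c = \<top>"
proof -
  \<comment> \<open>The automorphism moves \<open>z\<close> itself into the first argument, where
    (h) bounds the value by \<open>z\<close>.\<close>
  have "(car (z\<^sup>c) x)\<^sup>c = car z (x\<^sup>c)"
    by (metis car_car_top top_car_invol)
  also have "\<dots> \<le> x"
    using car_le assms by (rule order_trans)
  finally have "z\<^sup>c \<rightarrow> x = x"
    by (simp add: caret_imp_def sup_absorb1)
  then show ?thesis
    using imp_imp_same[of "z\<^sup>c" x] by (simp add: imp_self sup_commute)
qed

sublocale implication_algebra imp
proof
  fix x y
  have "x \<squnion> (car x y)\<^sup>c = \<top>"
    using car_le by (rule le_sup_compl_top)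
  then show "x \<squnion> (x \<rightarrow> y) = \<top>"
    by (simp add: caret_imp_def sup_left_commute[of x] sup_absorb2)
qed

text \<open>Below \<open>x\<close>, the map \<open>x \<rightarrow> _\<close> turns
  \<open>car x\<close> into the automorphism, so order and equality of values of
  \<open>car x\<close> can be tested there.\<close>

lemma imp_car: "y \<le> x \<Longrightarrow> x \<rightarrow> car x y = (x \<rightarrow> y)\<^sup>c"
  by (metis sup_imp_sup_car sup_absorb1)

lemma car_mono: "x \<le> y \<Longrightarrow> y \<le> z \<Longrightarrow> car z x \<le> car z y"
  by (rule le_if_imp_le_imp[OF car_le]) (simp add: imp_car imp_mono top_car_mono)

lemma car_invol: "x \<le> y \<Longrightarrow> car y (car y x) = x"
  by (rule eq_if_imp_eq[of _ y]) (simp_all add: car_le imp_car top_car_invol)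

text \<open>Both implications are compared relative to \<open>z\<close>, where \<open>car z\<close>
  acts as the automorphism and commutes with implication.\<close>

lemma car_imp_car:
  assumes "x \<le> y" and "y \<le> z"
  shows "car z y \<rightarrow> car z x = (y \<rightarrow> x)\<^sup>c"
proof -
  have "car z y \<rightarrow> car z x = (z \<rightarrow> car z y) \<rightarrow> (z \<rightarrow> car z x)"
    by (simp add: imp_imp_imp car_le)
  also have "\<dots> = ((z \<rightarrow> y) \<rightarrow> (z \<rightarrow> x))\<^sup>c"
    using assms by (simp add: imp_car compl_imp)
  also have "\<dots> = (y \<rightarrow> x)\<^sup>c"
    using assms by (simp add: imp_imp_imp)
  finally show ?thesis .
qed

lemma car_car_distrib:
  assumes "x \<le> y" and "y \<le> z"
  shows "car z (car y x) = car (car z y) (car z x)"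
proof (rule eq_if_imp_eq)
  show "car z (car y x) \<le> car z y"
    using assms by (simp add: car_mono car_le)
  \<comment> \<open>Each side is the automorphism applied twice to
    \<open>y \<rightarrow> x\<close>.\<close>
  show "car z y \<rightarrow> car z (car y x) = car z y \<rightarrow> car (car z y) (car z x)"
    using assms by (simp add: car_imp_car imp_car car_le car_mono)
qed (rule car_le)

lemma isGlb_car: "isGlb UNIV {x, car (x \<squnion> y) y} (car x y)"
proof (rule isGlbI2)
  show "isLb UNIV {x, car (x \<squnion> y) y} (car x y)"
    by (simp add: isLb_def setge_def car_le car_le_sup_car)
  \<comment> \<open>By (i), \<open>w\<close> lies below \<open>x \<rightarrow> car x y\<close>, so
    modus ponens applies.\<close>
  have "w \<le> car x y" if "w \<le> x" and "w \<le> car (x \<squnion> y) y" for w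
    using that(1) order_trans[OF that(2) sup_car_le_imp_car] by (rule le_if_le_imp)
  then show "Collect (isLb UNIV {x, car (x \<squnion> y) y}) *<= car x y"
    by (simp add: isLb_def setge_def setle_def)
qed

lemma MR_condition:
  assumes "a < x" and "b < x"
  shows "car x a \<squnion> b < x \<longleftrightarrow> \<not> (\<exists>m. isGlb UNIV {a, b} m)"
proof -
  \<comment> \<open>The join of \<open>b\<close> and \<open>car x a\<close> is \<open>x\<close>, and
    reflecting \<open>car x a\<close> in \<open>x\<close> gives back \<open>a\<close>.\<close>
  have "isGlb UNIV {a, b} (car b (car x a))" if "car x a \<squnion> b = x"
    using isGlb_car[of b "car x a"] that assms
    by (simp add: sup_commute car_invol insert_commute)
  moreover have "car x a \<squnion> b = x" if "isGlb UNIV {a, b} m" for m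
  proof (rule order_antisym)
    have "m \<le> a" and "m \<le> b"
      using isGlbD2[OF that] by simp_all
    \<comment> \<open>\<open>x\<close> is the join of \<open>m\<close> and its reflection; these lie
      below \<open>b\<close> and \<open>car x a\<close>.\<close>
    then have "car x m \<le> car x a" and "m \<squnion> car x m = x"
      using assms by (simp_all add: car_mono sup_car sup_absorb2)
    then show "x \<le> car x a \<squnion> b"
      using \<open>m \<le> b\<close> by (metis sup_mono sup_commute)
    show "car x a \<squnion> b \<le> x"
      using assms by (simp add: car_le)
  qed
  moreover have "car x a \<squnion> b \<le> x"
    using assms by (simp add: car_le)
  ultimately show ?thesis
    by (auto simp: less_le)
qed

text \<open>\<open>cubic_mult\<close> evaluates \<open>\<Delta>\<close> only at comparable pairs, so
  agreement there suffices; \<open>sup_imp\<close> removes the join in its premise.\<close>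

lemma cubic_mult_eq_imp:
  assumes "\<And>u v. v \<le> u \<Longrightarrow> \<Delta> u v = car u v"
  shows "cubic_mult \<Delta> x y = x \<rightarrow> y"
proof -
  have "cubic_mult \<Delta> x y = (x \<squnion> y) \<rightarrow> y"
    by (simp add: cubic_mult_def caret_imp_def assms sup_commute)
  then show ?thesis
    by (simp add: sup_imp)
qed

lemma MR_algebra_if_eq_car:
  assumes \<Delta>: "\<And>u v. v \<le> u \<Longrightarrow> \<Delta> u v = car u v"
  shows "MR_algebra \<Delta>"
proof
  fix x y z a b
  show "\<Delta> y x \<squnion> x = y" if "x \<le> y"
    using that by (metis \<Delta> sup_car sup_commute sup_absorb1)
  show "\<Delta> z (\<Delta> y x) = \<Delta> (\<Delta> z y) (\<Delta> z x)" if "x \<le> y" "y \<le> z"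
    using that order_trans[OF that] order_trans[OF car_le \<open>y \<le> z\<close>]
    by (simp add: \<Delta> car_mono car_car_distrib)
  show "\<Delta> y (\<Delta> y x) = x" if "x \<le> y"
    using that by (simp add: \<Delta> car_le car_invol)
  show "\<Delta> z x \<le> \<Delta> z y" if "x \<le> y" "y \<le> z"
    using that order_trans[OF that] by (simp add: \<Delta> car_mono)
  show "cubic_mult \<Delta> (cubic_mult \<Delta> x y) y = x \<squnion> y"
    by (simp add: cubic_mult_eq_imp[OF \<Delta>] imp_imp_same)
  show "cubic_mult \<Delta> x (cubic_mult \<Delta> y z) = cubic_mult \<Delta> y (cubic_mult \<Delta> x z)"
    by (simp add: cubic_mult_eq_imp[OF \<Delta>] imp_left_commute)
  show "\<Delta> x a \<squnion> b < x \<longleftrightarrow> \<not> (\<exists>m. isGlb UNIV {a, b} m)" if "a < x" "b < x"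
    using that MR_condition by (simp add: \<Delta>)
qed

end

theorem theorem3p14:
  fixes car :: "'a::{semilattice_sup,order_top} \<Rightarrow> 'a \<Rightarrow> 'a"
    and \<Delta> :: "'a \<Rightarrow> 'a \<Rightarrow> 'a"
  assumes a: "\<And>x y. x \<squnion> car y x = x \<squnion> y"
    and b: "\<And>x y. car (car \<top> x) (car \<top> y) = car \<top> (car x y)"
    and c: "\<And>x. car \<top> (car \<top> x) = x"
    and d: "\<And>x y. x \<le> y \<Longrightarrow> car \<top> x \<le> car \<top> y"
    and e1: "\<And>x y. caret_imp car (caret_imp car x y) y = x \<squnion> y"
    and e2: "\<And>x y z. caret_imp car x (caret_imp car y z) = caret_imp car y (caret_imp car x z)"
    and f: "\<And>x y. caret_imp car (x \<squnion> y) (car (x \<squnion> y) y) = car \<top> (caret_imp car x y)"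
    and g: "\<And>x y. car x y \<le> car (x \<squnion> y) y"
    and h: "\<And>x y. car x y \<le> x"
    and i: "\<And>x y. car (x \<squnion> y) y \<le> caret_imp car x (car x y)"
    and Delta_car: "\<And>u v. v \<le> u \<Longrightarrow> \<Delta> u v = car u v"
  shows "MR_algebra \<Delta> \<and> (\<forall>x y. isGlb UNIV {x, \<Delta> (x \<squnion> y) y} (car x y))"
proof -
  interpret caret_algebra car
    by (rule caret_algebra.intro) (fact a b c d e1 e2 f g h i)+
  show ?thesis
    using MR_algebra_if_eq_car[of \<Delta>] isGlb_car Delta_car by simp
qed

end
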